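(* Let $k^*\in\mathbb{Z}$, $\theta^*\in\Theta$, and let $Y=(Y_t)_{t\in\mathbb{Z}}$ be a time series with values in $\{0,1,2,\dots\}$ such that, with $\mathcal{F}_t=\sigma(Y_s,\ s\le t)$, $$Y_t\mid\mathcal{F}_{t-1}\sim\mathrm{Poisson}(\lambda_t),\qquad \lambda_t=E(Y_t\mid\mathcal{F}_{t-1})=f_{\theta^*}(Y_{t-1},Y_{t-2},\dots)\qquad\text{for all } t>k^*$$ (the structure of $(Y_t)_{t\le k^*}$ being otherwise unknown). Assume that $\theta^*$ belongs to the interior of $\Theta$, that $D(\Theta)$, $\mathrm{Id}(\Theta)$ and $A_0(\Theta)$ hold, the sequence in $A_0(\Theta)$ satisfying $\alpha_j^{(0)}=O(j^{-\gamma})$ for some $\gamma>3/2$, and that for every $r\ge1$ there exists $C_{r,0}>0$ with $E(Y_t^r)\le C_{r,0}$ for all $t\le k^*$. Let $\tilde Y$ be the stationary process associated with $\theta^*$, coupled with $Y$ after $k^*$ through common Poisson processes as described in the context. Then there exists $C>0$ such that for all integers $\ell\ge1$, $$E\big|Y_{k^*+\ell}-\tilde Y_{k^*+\ell}\big|\le C\,\inf_{1\le p\le\ell}\Big\{(\alpha^{(0)})^{\ell/p}+\sum_{k\ge p}\alpha_k^{(0)}\Big\},\qquad\text{where }\alpha^{(0)}=\sum_{k\ge1}\alpha_k^{(0)}$$ and the infimum is over integers $p$.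
   Context: $\Theta\subset\mathbb{R}^d$ is a compact set, and $(f_\theta)_{\theta\in\Theta}$ is a family of measurable non-negative functions $f_\theta:(\mathbb{R}^+)^{\mathbb{N}}\to[0,\infty)$, with $\mathbb{N}=\{1,2,\dots\}$, such that $\theta\mapsto f_\theta$ is twice continuously differentiable on $\Theta$. For a function $g$ on $\Theta$, $\|g\|_\Theta=\sup_{\theta\in\Theta}\|g(\theta)\|$, where $\|\cdot\|$ is the sum of absolute values of the coordinates. Assumption $A_0(\Theta)$: $\|f_\theta(0)\|_\Theta<\infty$ and there is a sequence of non-negative reals $(\alpha^{(0)}_k)_{k\ge1}$ with $\sum_{k\ge1}\alpha^{(0)}_k<1$ such that $\|f_\theta(y)-f_\theta(y')\|_\Theta\le\sum_{k\ge1}\alpha^{(0)}_k|y_k-y'_k|$ for all $y,y'\in(\mathbb{R}^+)^{\mathbb{N}}$. Assumption $D(\Theta)$: there is $\underline{c}>0$ such that $\inf_{\theta\in\Theta}f_\theta(y)\ge\underline{c}$ for all $y\in(\mathbb{R}^+)^{\mathbb{N}}$. Assumption $\mathrm{Id}(\Theta)$: for all $(\theta,\theta')\in\Theta^2$, if $f_\theta(Y_{t-1},Y_{t-2},\dots)=f_{\theta'}(Y_{t-1},Y_{t-2},\dots)$ a.s. for some $t>k^*$, then $\theta=\theta'$. Stationary regime and coupling: under $A_0(\Theta)$ there is a strictly stationary process $\tilde Y=(\tilde Y_t)_{t\in\mathbb{Z}}$ with finite moments of every order such that $\tilde Y_t\mid\tilde{\mathcal F}_{t-1}\sim\mathrm{Poisson}(\tilde\lambda_t)$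 with $\tilde\lambda_t=f_{\theta^*}(\tilde Y_{t-1},\tilde Y_{t-2},\dots)$ for all $t\in\mathbb{Z}$, where $\tilde{\mathcal F}_t=\sigma(\tilde Y_s,\ s\le t)$. The processes $Y$ and $\tilde Y$ are built on the same probability space from a common sequence $(N_t(\cdot))$ of independent Poisson processes of unit intensity: for all $t>k^*$, $Y_t=N_t(\lambda_t)$ and $\tilde Y_t=N_t(\tilde\lambda_t)$, where $N_t(\lambda)$ is the number of events of $N_t$ in $[0,\lambda]$, and $N_t$ is independent of $\sigma(Y_s,\tilde Y_s,\ s<t)$. *)

theory Defs
  imports "HOL-Probability.Probability" "HOL-Library.Landau_Symbols"
begin

text \<open>
  \<open>seq_space\<close> is \<open>(\<real>\<^sup>+)\<^sup>\<nat>\<close> with \<open>\<real>\<^sup>+ = [0, \<infinity>)\<close> and \<open>\<nat> = {1, 2, \<dots>}\<close>, carrying the product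
  sigma-algebra. Its points are functions on \<^typ>\<open>nat\<close> that are \<^term>\<open>undefined\<close> at index 0.
\<close>

definition seq_space :: "(nat \<Rightarrow> real) measure" where
  "seq_space = (\<Pi>\<^sub>M k\<in>{1..}. restrict_space borel {0..})"

definition zero_seq :: "nat \<Rightarrow> real" where
  "zero_seq = (\<lambda>k\<in>{1..}. 0)"

definition past :: "(int \<Rightarrow> 'a \<Rightarrow> nat) \<Rightarrow> int \<Rightarrow> 'a \<Rightarrow> nat \<Rightarrow> real" where
  "past X t \<omega> = (\<lambda>k\<in>{1..}. real (X (t - int k) \<omega>))"

text \<open>
  Values are taken in \<open>[0, \<infinity>]\<close>, so that an unbounded function has supremum \<open>\<infinity>\<close>.
\<close>

definition sup_norm :: "'p set \<Rightarrow> ('p \<Rightarrow> real) \<Rightarrow> ennreal" where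
  "sup_norm \<Theta> g = (SUP \<theta>\<in>\<Theta>. ennreal \<bar>g \<theta>\<bar>)"

text \<open>
  On a set that need not be open, derivatives are taken within the set. The gradient \<open>D\<close> is
  automatically continuous, being differentiable.
\<close>

definition C2_on :: "(real ^ 'd) set \<Rightarrow> (real ^ 'd \<Rightarrow> real) \<Rightarrow> bool" where
  "C2_on S g \<longleftrightarrow>
     (\<exists>(D :: real ^ 'd \<Rightarrow> real ^ 'd) (H :: real ^ 'd \<Rightarrow> real ^ 'd ^ 'd).
        (\<forall>x\<in>S. (g has_derivative (\<lambda>h. D x \<bullet> h)) (at x within S)) \<and>
        (\<forall>x\<in>S. (D has_derivative (\<lambda>h. H x *v h)) (at x within S)) \<and>
        continuous_on S H)"

text \<open>
  The Lipschitz bound is stated in \<open>[0, \<infinity>]\<close>: it says nothing when the series on the right diverges.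
\<close>

definition assumption_A0 ::
  "'p set \<Rightarrow> ('p \<Rightarrow> (nat \<Rightarrow> real) \<Rightarrow> real) \<Rightarrow> (nat \<Rightarrow> real) \<Rightarrow> bool" where
  "assumption_A0 \<Theta> f \<alpha> \<longleftrightarrow>
     sup_norm \<Theta> (\<lambda>\<theta>. f \<theta> zero_seq) < \<infinity> \<and>
     (\<forall>k\<ge>1. 0 \<le> \<alpha> k) \<and> \<alpha> summable_on {1..} \<and> (\<Sum>\<^sub>\<infinity>k\<in>{1..}. \<alpha> k) < 1 \<and>
     (\<forall>y\<in>space seq_space. \<forall>y'\<in>space seq_space.
        sup_norm \<Theta> (\<lambda>\<theta>. f \<theta> y - f \<theta> y') \<le> (\<Sum>\<^sub>\<infinity>k\<in>{1..}. ennreal (\<alpha> k * \<bar>y k - y' k\<bar>)))"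

definition assumption_D :: "'p set \<Rightarrow> ('p \<Rightarrow> (nat \<Rightarrow> real) \<Rightarrow> real) \<Rightarrow> bool" where
  "assumption_D \<Theta> f \<longleftrightarrow>
     (\<exists>c>0. \<forall>y\<in>space seq_space. c \<le> (INF \<theta>\<in>\<Theta>. f \<theta> y))"

definition assumption_Id ::
  "'a measure \<Rightarrow> (int \<Rightarrow> 'a \<Rightarrow> nat) \<Rightarrow> int \<Rightarrow> 'p set \<Rightarrow> ('p \<Rightarrow> (nat \<Rightarrow> real) \<Rightarrow> real) \<Rightarrow> bool" where
  "assumption_Id M Y kstar \<Theta> f \<longleftrightarrow>
     (\<forall>\<theta>\<in>\<Theta>. \<forall>\<theta>'\<in>\<Theta>.
        (\<exists>t>kstar. AE \<omega> in M. f \<theta> (past Y t \<omega>) = f \<theta>' (past Y t \<omega>)) \<longrightarrow> \<theta> = \<theta>')"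

text \<open>
  The sigma-algebra generated by the variables \<open>X i\<close>, \<open>i \<in> I\<close>, whose value space is given the
  discrete sigma-algebra (it is used for countable value spaces only).
\<close>

definition gen_sigma :: "'a measure \<Rightarrow> ('i \<Rightarrow> 'a \<Rightarrow> 'b) \<Rightarrow> 'i set \<Rightarrow> 'a measure" where
  "gen_sigma M X I = sigma (space M) {X i -` A \<inter> space M | i A. i \<in> I}"

text \<open>
  \<open>X | F \<sim> Poisson(R)\<close> with a random rate \<open>R\<close>. Since \<^const>\<open>poisson_pmf\<close> is unspecified at
  nonpositive rates, this is meant for \<open>R > 0\<close>.
\<close>

definition cond_poisson ::
  "'a measure \<Rightarrow> 'a measure \<Rightarrow> ('a \<Rightarrow> nat) \<Rightarrow> ('a \<Rightarrow> real) \<Rightarrow> bool" where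
  "cond_poisson M F X R \<longleftrightarrow>
     (\<forall>n. AE \<omega> in M.
        real_cond_exp M F (indicator {\<omega> \<in> space M. X \<omega> = n}) \<omega> = pmf (poisson_pmf (R \<omega>)) n)"

definition strictly_stationary :: "'a measure \<Rightarrow> (int \<Rightarrow> 'a \<Rightarrow> nat) \<Rightarrow> bool" where
  "strictly_stationary M X \<longleftrightarrow>
     (\<forall>J h. finite J \<longrightarrow>
        distr M (\<Pi>\<^sub>M t\<in>J. count_space UNIV) (\<lambda>\<omega>. \<lambda>t\<in>J. X (t + h) \<omega>) =
        distr M (\<Pi>\<^sub>M t\<in>J. count_space UNIV) (\<lambda>\<omega>. \<lambda>t\<in>J. X t \<omega>))"

text \<open>
  \<open>N s \<omega>\<close> is the number of events in \<open>[0, s]\<close>; only \<open>s \<ge> 0\<close> is meaningful. The subtractions on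
  \<^typ>\<open>nat\<close> do not truncate, up to a null set, as almost all paths are nondecreasing.
\<close>

definition unit_poisson_process :: "'a measure \<Rightarrow> (real \<Rightarrow> 'a \<Rightarrow> nat) \<Rightarrow> bool" where
  "unit_poisson_process M N \<longleftrightarrow>
     (\<forall>s\<ge>0. N s \<in> measurable M (count_space UNIV)) \<and>
     (AE \<omega> in M. N 0 \<omega> = 0 \<and> mono_on {0..} (\<lambda>s. N s \<omega>) \<and>
        (\<forall>s\<ge>0. continuous (at_right s) (\<lambda>u. N u \<omega>))) \<and>
     (\<forall>n (s :: nat \<Rightarrow> real). 0 \<le> s 0 \<and> strict_mono_on {..n} s \<longrightarrow>
        prob_space.indep_vars M (\<lambda>_. count_space UNIV)
          (\<lambda>i \<omega>. N (s (Suc i)) \<omega> - N (s i) \<omega>) {..<n}) \<and>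
     (\<forall>s u. 0 \<le> s \<and> s < u \<longrightarrow>
        distr M (count_space UNIV) (\<lambda>\<omega>. N u \<omega> - N s \<omega>) = measure_pmf (poisson_pmf (u - s)))"

definition stationary_regime ::
  "'a measure \<Rightarrow> ((nat \<Rightarrow> real) \<Rightarrow> real) \<Rightarrow> (int \<Rightarrow> 'a \<Rightarrow> nat) \<Rightarrow> bool" where
  "stationary_regime M g X \<longleftrightarrow>
     (\<forall>t. X t \<in> measurable M (count_space UNIV)) \<and>
     strictly_stationary M X \<and>
     (\<forall>t (r::nat). integrable M (\<lambda>\<omega>. real (X t \<omega>) ^ r)) \<and>
     (\<forall>t. cond_poisson M (gen_sigma M X {..t - 1}) (X t) (\<lambda>\<omega>. g (past X t \<omega>)))"

definition poisson_coupling ::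
  "'a measure \<Rightarrow> int \<Rightarrow> ((nat \<Rightarrow> real) \<Rightarrow> real) \<Rightarrow> (int \<Rightarrow> real \<Rightarrow> 'a \<Rightarrow> nat) \<Rightarrow>
    (int \<Rightarrow> 'a \<Rightarrow> nat) \<Rightarrow> (int \<Rightarrow> 'a \<Rightarrow> nat) \<Rightarrow> bool" where
  "poisson_coupling M kstar g N Y Y' \<longleftrightarrow>
     (\<forall>t>kstar. unit_poisson_process M (N t)) \<and>
     prob_space.indep_sets M (\<lambda>t. sets (gen_sigma M (N t) {0..})) {kstar<..} \<and>
     (\<forall>t>kstar. AE \<omega> in M. Y t \<omega> = N t (g (past Y t \<omega>)) \<omega>) \<and>
     (\<forall>t>kstar. AE \<omega> in M. Y' t \<omega> = N t (g (past Y' t \<omega>)) \<omega>) \<and>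
     (\<forall>t>kstar. prob_space.indep_set M (sets (gen_sigma M (N t) {0..}))
        (sets (gen_sigma M (\<lambda>s \<omega>. (Y s \<omega>, Y' s \<omega>)) {..<t})))"

end

theory Submission
  imports Defs
begin

text \<open>
  Let \<open>d\<^sub>l = E|Y\<^bsub>k*+l\<^esub> - Y'\<^bsub>k*+l\<^esub>|\<close>. Since both variables read the same Poisson process, which is
  independent of the past, \<open>d\<^sub>l \<le> E|\<lambda> - \<lambda>'|\<close>, and the Lipschitz assumption gives the renewal
  inequality \<open>d\<^sub>l \<le> \<Sum>\<^bsub>k\<ge>1\<^esub> \<alpha>\<^sub>k d\<^bsub>l-k\<^esub>\<close> for \<open>l \<ge> 1\<close>, while \<open>d\<close> is bounded on \<open>l \<le> 0\<close>. Induction on \<open>l\<close>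
  turns it into the stated bound, simultaneously for all \<open>p\<close>.
\<close>

section \<open>Unconditional sums of nonnegative terms\<close>

text \<open>Every family in \<open>ennreal\<close> is summable, so after padding with zeros outside
  \<open>A\<close> the unconditional sum is an ordinary series. This opens the way to the facts on
  \<open>suminf\<close>, monotone convergence in particular.\<close>

lemma infsum_eq_suminf_ennreal:
  fixes g :: "nat \<Rightarrow> ennreal"
  shows "infsum g A = (\<Sum>i. if i \<in> A then g i else 0)"
proof -
  have "infsum g A = infsum (\<lambda>i. if i \<in> A then g i else 0) UNIV"
    by (rule infsum_cong_neutral) auto
  moreover have "(\<lambda>i. if i \<in> A then g i else 0) sums infsum (\<lambda>i. if i \<in> A then g i else 0) UNIV"
    by (intro has_sum_imp_sums has_sum_infsum nonneg_summable_on_complete) simp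
  ultimately show ?thesis
    by (simp add: sums_iff)
qed

lemma nn_integral_infsum:
  fixes g :: "nat \<Rightarrow> 'a \<Rightarrow> ennreal"
  assumes [measurable]: "\<And>i. i \<in> A \<Longrightarrow> g i \<in> borel_measurable M"
  shows "(\<integral>\<^sup>+x. (\<Sum>\<^sub>\<infinity>i\<in>A. g i x) \<partial>M) = (\<Sum>\<^sub>\<infinity>i\<in>A. \<integral>\<^sup>+x. g i x \<partial>M)"
proof -
  have "(\<integral>\<^sup>+x. (\<Sum>\<^sub>\<infinity>i\<in>A. g i x) \<partial>M) = (\<Sum>i. \<integral>\<^sup>+x. (if i \<in> A then g i x else 0) \<partial>M)"
    unfolding infsum_eq_suminf_ennreal by (rule nn_integral_suminf, case_tac "i \<in> A") auto
  also have "\<dots> = (\<Sum>i. if i \<in> A then \<integral>\<^sup>+x. g i x \<partial>M else 0)"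
    by (intro arg_cong[where f=suminf] ext) simp
  finally show ?thesis
    by (simp add: infsum_eq_suminf_ennreal)
qed

text \<open>The embedding \<open>ennreal\<close> is continuous, and additive on nonnegative reals.
  Since all finite partial sums stay nonnegative, it passes through the limit that defines
  \<open>infsum\<close>.\<close>

lemma infsum_ennreal:
  fixes g :: "'i \<Rightarrow> real"
  assumes "\<And>i. i \<in> A \<Longrightarrow> 0 \<le> g i" and "g summable_on A"
  shows "(\<Sum>\<^sub>\<infinity>i\<in>A. ennreal (g i)) = ennreal (infsum g A)"
proof -
  have "infsum (ennreal \<circ> g) A = ennreal (infsum g A)"
  proof (rule infsum_comm_additive_general)
    show "isCont ennreal (infsum g A)"
      using continuous_on_ennreal[of UNIV "\<lambda>x. x"] by (simp add: continuous_on_eq_continuous_at)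
  qed (use assms in \<open>auto simp: sum_ennreal subset_eq\<close>)
  then show ?thesis by (simp add: comp_def)
qed

section \<open>From the renewal inequality to the decay bound\<close>

text \<open>
  For \<open>l \<le> 0\<close> the invariant \<open>d l \<le> B (a powr (l / p) + T / (1 - a))\<close> is implied by \<open>d l \<le> B\<close>.
  Lags \<open>k < p\<close> turn the power into \<open>a powr (l / p - 1)\<close>, which the factor \<open>\<Sum>\<alpha>\<^sub>k \<le> a\<close> restores;
  lags \<open>k \<ge> p\<close> contribute at most \<open>B T\<close>.
\<close>
lemma renewal_inequality_bound:
  fixes \<alpha> :: "nat \<Rightarrow> real" and d :: "int \<Rightarrow> ennreal" and B :: real
  defines "a \<equiv> \<Sum>\<^sub>\<infinity>k\<in>{1..}. \<alpha> k"
  assumes nonneg: "\<And>k. k \<ge> 1 \<Longrightarrow> 0 \<le> \<alpha> k" and summable: "\<alpha> summable_on {1..}" and "a < 1"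
    and "0 \<le> B" and init: "\<And>l. l \<le> 0 \<Longrightarrow> d l \<le> ennreal B"
    and step: "\<And>l. l \<ge> 1 \<Longrightarrow> d l \<le> (\<Sum>\<^sub>\<infinity>k\<in>{1..}. ennreal (\<alpha> k) * d (l - int k))"
    and "l \<ge> 1" and "p \<ge> 1"
  shows "d l \<le> ennreal (B / (1 - a) * (a powr (real_of_int l / real p) + (\<Sum>\<^sub>\<infinity>k\<in>{p..}. \<alpha> k)))"
proof -
  define T where "T = (\<Sum>\<^sub>\<infinity>k\<in>{p..}. \<alpha> k)"
  have a0: "0 \<le> a" unfolding a_def by (rule infsum_nonneg) (use nonneg in auto)
  have T0: "0 \<le> T" unfolding T_def by (rule infsum_nonneg) (use nonneg \<open>p \<ge> 1\<close> in auto)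
  have summable_tail: "\<alpha> summable_on {p..}"
    by (rule summable_on_subset_banach[OF summable]) (use \<open>p \<ge> 1\<close> in auto)
  \<comment> \<open>Both inductions below use the renewal inequality in this form: a real summable
    majorant of the terms replaces a sum in \<open>ennreal\<close> by a real sum that can be
    computed.\<close>
  have bound: "d l \<le> ennreal (infsum g {1..})"
    if "l \<ge> 1" "g summable_on {1..}" "\<And>k. k \<ge> 1 \<Longrightarrow> 0 \<le> g k"
      "\<And>k. k \<ge> 1 \<Longrightarrow> ennreal (\<alpha> k) * d (l - int k) \<le> ennreal (g k)" for l g
  proof -
    have "d l \<le> (\<Sum>\<^sub>\<infinity>k\<in>{1..}. ennreal (\<alpha> k) * d (l - int k))"
      by (rule step) fact
    also have "\<dots> \<le> (\<Sum>\<^sub>\<infinity>k\<in>{1..}. ennreal (g k))"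
      by (rule infsum_mono) (use that in \<open>auto intro: nonneg_summable_on_complete\<close>)
    also have "\<dots> = ennreal (infsum g {1..})"
      by (rule infsum_ennreal) (use that in auto)
    finally show ?thesis .
  qed
  \<comment> \<open>The total weight \<open>a\<close> is below 1, so the bound \<open>B\<close> on
    the initial segment is never exceeded later. The sharper \<open>daB\<close> serves the case
    \<open>a = 0\<close>, where it forces \<open>d l\<close> to vanish.\<close>
  have dB: "d l \<le> ennreal B" and daB: "l \<ge> 1 \<Longrightarrow> d l \<le> ennreal (a * B)" for l
  proof -
    have "d l \<le> ennreal B \<and> (l \<ge> 1 \<longrightarrow> d l \<le> ennreal (a * B))"
    \<comment> \<open>All \<open>l\<close> at or below 0 share the measure 0 and are covered by
      \<open>init\<close>. For \<open>l\<close> at least 1, each lag of at least 1 strictly lowers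
      the measure, even when it leads below 0.\<close>
    proof (induction "nat l" arbitrary: l rule: less_induct)
      case less
      show ?case
      proof (cases "l \<le> 0")
        case False
        have "d l \<le> ennreal (\<Sum>\<^sub>\<infinity>k\<in>{1..}. \<alpha> k * B)"
        proof (rule bound)
          fix k :: nat assume "k \<ge> 1"
          then have "d (l - int k) \<le> ennreal B"
            using less[of "l - int k"] False by auto
          then show "ennreal (\<alpha> k) * d (l - int k) \<le> ennreal (\<alpha> k * B)"
            using nonneg \<open>k \<ge> 1\<close> \<open>0 \<le> B\<close> by (simp add: ennreal_mult mult_left_mono)
        qed (use False nonneg \<open>0 \<le> B\<close> in \<open>auto intro!: summable_on_cmult_left summable[simplified]\<close>)
        also have "(\<Sum>\<^sub>\<infinity>k\<in>{1..}. \<alpha> k * B) = a * B"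
          unfolding a_def by (rule infsum_cmult_left) (use summable in auto)
        finally have "d l \<le> ennreal (a * B)" .
        moreover have "ennreal (a * B) \<le> ennreal B"
          using \<open>a < 1\<close> \<open>0 \<le> B\<close> a0 by (intro ennreal_leI mult_left_le_one_le) auto
        ultimately show ?thesis by auto
      qed (simp add: init)
    qed
    then show "d l \<le> ennreal B" "l \<ge> 1 \<Longrightarrow> d l \<le> ennreal (a * B)" by auto
  qed
  \<comment> \<open>Positivity of \<open>a\<close> matters at the start of the induction:
    \<open>0 powr x\<close> is 0 for every \<open>x\<close>, so with \<open>a = 0\<close> the power
    would not dominate 1 at \<open>l\<close> below or equal to 0.\<close>
  have claim: "d l \<le> ennreal (B * (a powr (real_of_int l / real p) + T / (1 - a)))" if "0 < a" for l
  proof (induction "nat l" arbitrary: l rule: less_induct)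
    case less
    show ?case
    proof (cases "l \<le> 0")
      case True
      have "1 \<le> a powr (real_of_int l / real p)"
        using True \<open>0 < a\<close> \<open>a < 1\<close> powr_mono'[of "real_of_int l / real p" 0 a]
        by (auto simp: divide_nonpos_nonneg)
      then have "B * 1 \<le> B * (a powr (real_of_int l / real p) + T / (1 - a))"
        using \<open>0 \<le> B\<close> T0 \<open>a < 1\<close> by (intro mult_left_mono) (auto intro: add_increasing2)
      then show ?thesis
        using dB[of l] by (auto intro: order_trans ennreal_leI)
    next
      case False
      define D where "D = B * (a powr (real_of_int l / real p - 1) + T / (1 - a))"
      \<comment> \<open>The term with \<open>D\<close> is kept for long lags too. This only enlarges
        the majorant, and its sum is then exactly \<open>a * D + T * B\<close>.\<close>
      define g where "g k = \<alpha> k * D + (if k \<in> {p..} then \<alpha> k else 0) * B" for k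
      have D0: "0 \<le> D"
        using \<open>0 \<le> B\<close> T0 \<open>a < 1\<close> by (auto simp: D_def)
      have summable': "(\<lambda>k. if k \<in> {p..} then \<alpha> k else 0) summable_on {1..}"
        using summable_tail
        by (rule summable_on_cong_neutral[THEN iffD1, rotated -1]) (use \<open>p \<ge> 1\<close> in auto)
      have "d l \<le> ennreal (infsum g {1..})"
      proof (rule bound)
        show "g summable_on {1..}"
          unfolding g_def by (intro summable_on_add summable_on_cmult_left summable summable')
        fix k :: nat assume "k \<ge> 1"
        show "0 \<le> g k"
          using nonneg \<open>k \<ge> 1\<close> \<open>0 \<le> B\<close> D0 by (auto simp: g_def)
        show "ennreal (\<alpha> k) * d (l - int k) \<le> ennreal (g k)"
        proof (cases "k < p")
          case True
          have "d (l - int k) \<le> ennreal (B * (a powr (real_of_int (l - int k) / real p) + T / (1 - a)))"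
            by (rule less) (use False \<open>k \<ge> 1\<close> in auto)
          also have "\<dots> \<le> ennreal D"
            unfolding D_def using \<open>0 \<le> B\<close> \<open>0 < a\<close> \<open>a < 1\<close> True
            by (intro ennreal_leI mult_left_mono add_right_mono powr_mono') (auto simp: field_simps)
          finally show ?thesis
            using nonneg \<open>k \<ge> 1\<close> D0 True by (simp add: g_def ennreal_mult mult_left_mono)
        next
          case pk: False
          have "ennreal (\<alpha> k) * d (l - int k) \<le> ennreal (\<alpha> k * B)"
            using nonneg \<open>k \<ge> 1\<close> \<open>0 \<le> B\<close> dB by (simp add: ennreal_mult mult_left_mono)
          also have "\<dots> \<le> ennreal (g k)"
            unfolding g_def using nonneg \<open>k \<ge> 1\<close> D0 pk by (intro ennreal_leI) auto
          finally show ?thesis .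
        qed
      qed (use False in auto)
      also have "infsum g {1..} = a * D + (\<Sum>\<^sub>\<infinity>k\<in>{1..}. if k \<in> {p..} then \<alpha> k else 0) * B"
        unfolding g_def a_def
        by (simp only: infsum_add summable_on_cmult_left summable summable' infsum_cmult_left')
      also have "(\<Sum>\<^sub>\<infinity>k\<in>{1..}. if k \<in> {p..} then \<alpha> k else 0) = T"
        unfolding T_def by (rule infsum_cong_neutral) (use \<open>p \<ge> 1\<close> in auto)
      also have "a * D + T * B = B * (a powr (real_of_int l / real p) + T / (1 - a))"
      proof -
        have "a * a powr (real_of_int l / real p - 1) = a powr (real_of_int l / real p)"
          using \<open>0 < a\<close> by (simp add: powr_diff)
        \<comment> \<open>This is where the factor \<open>1 / (1 - a)\<close> comes from:
          \<open>T / (1 - a)\<close> is the fixed point of the map sending \<open>x\<close> to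
          \<open>a * x + T\<close>, so the additive error does not grow along the induction.\<close>
        moreover have "a * (T / (1 - a)) + T = T / (1 - a)"
          using \<open>a < 1\<close> by (simp add: field_simps)
        ultimately show ?thesis
          unfolding D_def by (metis (no_types, opaque_lifting) add.assoc distrib_left mult.commute mult.left_commute)
      qed
      finally show ?thesis .
    qed
  qed
  show ?thesis
  proof (cases "a = 0")
    case True
    then show ?thesis
      using daB[OF \<open>l \<ge> 1\<close>] by simp
  next
    case False
    \<comment> \<open>Since \<open>1 - a\<close> is at most 1, the power may be divided by it as
      well, which puts \<open>1 / (1 - a)\<close> in front of both terms.\<close>
    have "(1 - a) * a powr (real_of_int l / real p) \<le> 1 * a powr (real_of_int l / real p)"
      using a0 by (intro mult_right_mono) auto
    then have "a powr (real_of_int l / real p) + T / (1 - a) \<le> (a powr (real_of_int l / real p) + T) / (1 - a)"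
      using \<open>a < 1\<close> by (simp add: add_divide_distrib pos_le_divide_eq mult.commute)
    from mult_left_mono[OF this \<open>0 \<le> B\<close>]
    have "B * (a powr (real_of_int l / real p) + T / (1 - a))
        \<le> B / (1 - a) * (a powr (real_of_int l / real p) + T)"
      by simp
    with claim[of l] False a0 show ?thesis
      unfolding T_def by (auto intro: order_trans ennreal_leI)
  qed
qed

section \<open>Mean increments of a unit Poisson process\<close>

text \<open>Cancelling the factor \<open>n\<close> against \<open>fact n\<close> leaves
  \<open>r * exp (-r)\<close> times the exponential series, shifted by one index. The term at 0
  vanishes, so \<open>sums_Suc\<close> adds nothing.\<close>

lemma nn_integral_poisson_pmf:
  assumes "0 < r"
  shows "(\<integral>\<^sup>+n. of_nat n \<partial>measure_pmf (poisson_pmf r)) = ennreal r"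
proof -
  define h where "h n = pmf (poisson_pmf r) n * real n" for n
  have "(\<lambda>n. r * exp (-r) * (r ^ n /\<^sub>R fact n)) sums (r * exp (-r) * exp r)"
    by (intro sums_mult exp_converges)
  also have "(\<lambda>n. r * exp (-r) * (r ^ n /\<^sub>R fact n)) = (\<lambda>n. h (Suc n))"
    using assms by (auto simp: h_def fun_eq_iff fact_Suc divide_simps simp del: of_nat_Suc)
  also have "r * exp (-r) * exp r = r"
    by (simp add: exp_minus)
  finally have "h sums (r + h 0)"
    by (rule sums_Suc)
  then have "h sums r"
    by (simp add: h_def)
  have "(\<integral>\<^sup>+n. of_nat n \<partial>measure_pmf (poisson_pmf r)) = (\<Sum>n. ennreal (h n))"
    by (simp add: nn_integral_measure_pmf nn_integral_count_space_nat h_def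
        ennreal_mult ennreal_of_nat_eq_real_of_nat del: pmf_poisson)
  also have "\<dots> = ennreal r"
    by (rule suminf_ennreal_eq[OF _ \<open>h sums r\<close>]) (simp add: h_def del: pmf_poisson)
  finally show ?thesis .
qed

text \<open>Almost all paths are nondecreasing, so the absolute difference is the increment over the
  interval between the two times, whose Poisson mean is the length. Equal times are treated apart,
  since \<open>poisson_pmf\<close> needs a positive rate.\<close>

lemma nn_integral_abs_diff_unit_poisson_process:
  assumes N: "unit_poisson_process M N" and "0 \<le> s" "0 \<le> u"
  shows "(\<integral>\<^sup>+\<omega>. ennreal \<bar>real (N s \<omega>) - real (N u \<omega>)\<bar> \<partial>M) = ennreal \<bar>s - u\<bar>"
proof -
  have less: "(\<integral>\<^sup>+\<omega>. ennreal \<bar>real (N s \<omega>) - real (N u \<omega>)\<bar> \<partial>M) = ennreal \<bar>s - u\<bar>"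
    if "0 \<le> s" "s < u" for s u
  proof -
    have [measurable]: "N s \<in> measurable M (count_space UNIV)" "N u \<in> measurable M (count_space UNIV)"
      using N that by (auto simp: unit_poisson_process_def)
    have "AE \<omega> in M. mono_on {0..} (\<lambda>s. N s \<omega>)"
      using N by (auto simp: unit_poisson_process_def)
    then have "AE \<omega> in M. N s \<omega> \<le> N u \<omega>"
      by eventually_elim (use that in \<open>auto simp: monotone_on_def\<close>)
    then have "(\<integral>\<^sup>+\<omega>. ennreal \<bar>real (N s \<omega>) - real (N u \<omega>)\<bar> \<partial>M) = (\<integral>\<^sup>+\<omega>. of_nat (N u \<omega> - N s \<omega>) \<partial>M)"
      by (intro nn_integral_cong_AE, eventually_elim)
         (auto simp: ennreal_of_nat_eq_real_of_nat of_nat_diff)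
    also have "\<dots> = (\<integral>\<^sup>+n. of_nat n \<partial>distr M (count_space UNIV) (\<lambda>\<omega>. N u \<omega> - N s \<omega>))"
      by (subst nn_integral_distr) auto
    also have "distr M (count_space UNIV) (\<lambda>\<omega>. N u \<omega> - N s \<omega>) = measure_pmf (poisson_pmf (u - s))"
      using N that by (auto simp: unit_poisson_process_def)
    finally show ?thesis
      using that by (simp add: nn_integral_poisson_pmf)
  qed
  show ?thesis
    using less[of s u] less[of u s] assms(2,3)
    by (cases s u rule: linorder_cases) (auto simp: abs_minus_commute)
qed

section \<open>Independence and decomposition over countably many values\<close>

lemma space_gen_sigma [simp]: "space (gen_sigma M X I) = space M"
  by (simp add: gen_sigma_def space_measure_of_conv)

lemma measurable_gen_sigma:
  assumes "i \<in> I"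
  shows "X i \<in> measurable (gen_sigma M X I) (count_space UNIV)"
proof (rule measurableI)
  fix A
  have "{X i -` A \<inter> space M | i A. i \<in> I} \<subseteq> Pow (space M)" by auto
  with assms show "X i -` A \<inter> space (gen_sigma M X I) \<in> sets (gen_sigma M X I)"
    by (auto simp: gen_sigma_def space_measure_of_conv intro: sigma_sets.Basic)
qed auto

text \<open>The expectation of a natural-number variable is the sum of its tail probabilities.
  Cutting with \<open>A\<close> intersects each tail event with \<open>A\<close>, and independence
  factors the series term by term, without any integrability of \<open>W\<close>.\<close>

lemma (in prob_space) nn_integral_nat_indicator_indep:
  fixes W :: "'a \<Rightarrow> nat"
  assumes indep: "indep_set (sets F) (sets G)" and W: "W \<in> measurable F (count_space UNIV)"
    and A: "A \<in> sets G" and [simp]: "space F = space M"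
  shows "(\<integral>\<^sup>+\<omega>. of_nat (W \<omega>) * indicator A \<omega> \<partial>M) = (\<integral>\<^sup>+\<omega>. of_nat (W \<omega>) \<partial>M) * emeasure M A"
proof -
  have sets: "sets F \<subseteq> sets M" "sets G \<subseteq> sets M"
    using indep by (auto simp: indep_set_def indep_sets_def UNIV_bool)
  have [measurable]: "A \<in> sets M" using A sets by auto
  have [measurable]: "W \<in> measurable M (count_space UNIV)"
    using W sets by (auto simp: measurable_def)
  have level: "{\<omega> \<in> space M. t < W \<omega>} \<in> sets F" for t
    using measurable_sets[OF W, of "{t<..}"] by (simp add: vimage_def Int_def conj_commute)
  have "(\<integral>\<^sup>+\<omega>. of_nat (W \<omega>) * indicator A \<omega> \<partial>M) = (\<integral>\<^sup>+\<omega>. of_nat (if \<omega> \<in> A then W \<omega> else 0) \<partial>M)"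
    by (intro nn_integral_cong) (auto split: split_indicator)
  also have "\<dots> = (\<Sum>t. emeasure M {\<omega> \<in> space M. t < (if \<omega> \<in> A then W \<omega> else 0)})"
    by (rule nn_integral_nat_function) simp
  also have "\<dots> = (\<Sum>t. emeasure M {\<omega> \<in> space M. t < W \<omega>} * emeasure M A)"
  proof (rule arg_cong[where f=suminf], rule ext)
    fix t
    have "{\<omega> \<in> space M. t < (if \<omega> \<in> A then W \<omega> else 0)} = {\<omega> \<in> space M. t < W \<omega>} \<inter> A"
      using sets.sets_into_space[of A M] by auto
    then show "emeasure M {\<omega> \<in> space M. t < (if \<omega> \<in> A then W \<omega> else 0)} =
        emeasure M {\<omega> \<in> space M. t < W \<omega>} * emeasure M A"
      using indep_setD[OF indep level A] by (simp add: emeasure_eq_measure ennreal_mult)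
  qed
  also have "\<dots> = (\<integral>\<^sup>+\<omega>. of_nat (W \<omega>) \<partial>M) * emeasure M A"
    by (simp add: nn_integral_nat_function ennreal_suminf_multc)
  finally show ?thesis .
qed

text \<open>Integrates a family of functions at a random index. Splitting along the values of
  \<open>K\<close> and exchanging sum and integral leaves the terms in \<open>eq\<close>, which
  independence supplies in the application below. The same splitting, applied to the constant
  functions \<open>c i\<close>, reassembles the right-hand side.\<close>

lemma nn_integral_compose_countable:
  fixes K :: "'a \<Rightarrow> 'i :: countable"
  assumes K[measurable]: "K \<in> measurable M (count_space UNIV)"
    and h[measurable]: "\<And>i. h i \<in> borel_measurable M"
    and eq: "\<And>i. (\<integral>\<^sup>+\<omega>. h i \<omega> * indicator {\<omega> \<in> space M. K \<omega> = i} \<omega> \<partial>M) =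
      c i * emeasure M {\<omega> \<in> space M. K \<omega> = i}"
  shows "(\<integral>\<^sup>+\<omega>. h (K \<omega>) \<omega> \<partial>M) = (\<integral>\<^sup>+\<omega>. c (K \<omega>) \<partial>M)"
proof -
  have split: "(\<integral>\<^sup>+\<omega>. g (K \<omega>) \<omega> \<partial>M) =
      (\<integral>\<^sup>+i. \<integral>\<^sup>+\<omega>. g i \<omega> * indicator {\<omega> \<in> space M. K \<omega> = i} \<omega> \<partial>M \<partial>count_space UNIV)"
    if [measurable]: "\<And>i. g i \<in> borel_measurable M" for g :: "'i \<Rightarrow> 'a \<Rightarrow> ennreal"
  proof -
    have "(\<integral>\<^sup>+\<omega>. g (K \<omega>) \<omega> \<partial>M) =
        (\<integral>\<^sup>+\<omega>. \<integral>\<^sup>+i. g i \<omega> * indicator {\<omega> \<in> space M. K \<omega> = i} \<omega> \<partial>count_space UNIV \<partial>M)"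
    proof (rule nn_integral_cong)
      fix \<omega> assume "\<omega> \<in> space M"
      then have "(\<integral>\<^sup>+i. g i \<omega> * indicator {\<omega> \<in> space M. K \<omega> = i} \<omega> \<partial>count_space UNIV) =
          (\<integral>\<^sup>+i. g i \<omega> * indicator {K \<omega>} i \<partial>count_space UNIV)"
        by (intro nn_integral_cong) (auto split: split_indicator)
      also have "\<dots> = g (K \<omega>) \<omega>"
        by (simp add: nn_integral_indicator_singleton one_ennreal_def[symmetric])
      finally show "g (K \<omega>) \<omega> =
          (\<integral>\<^sup>+i. g i \<omega> * indicator {\<omega> \<in> space M. K \<omega> = i} \<omega> \<partial>count_space UNIV)" by simp
    qed
    also have "\<dots> = (\<integral>\<^sup>+i. \<integral>\<^sup>+\<omega>. g i \<omega> * indicator {\<omega> \<in> space M. K \<omega> = i} \<omega> \<partial>M \<partial>count_space UNIV)"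
      by (rule nn_integral_count_space_nn_integral) auto
    finally show ?thesis .
  qed
  show ?thesis
    by (simp add: split[of h] split[of "\<lambda>i _. c i"] eq nn_integral_cmult_indicator)
qed

section \<open>Poisson counts at random intensities\<close>

text \<open>
  The process is only known to be measurable at fixed times, so the random times are approximated
  from above by grid points \<open>(i + 1) / (n + 1)\<close>: right continuity and Fatou's lemma pass to the
  limit, and at grid points independence applies value by value.
\<close>
lemma (in prob_space) nn_integral_abs_diff_poisson_coupling_le:
  assumes N: "unit_poisson_process M N"
    and indep: "indep_set (sets (gen_sigma M N {0..})) (sets G)"
    and space[simp]: "space G = space M"
    and L: "L \<in> borel_measurable G" "\<And>\<omega>. \<omega> \<in> space M \<Longrightarrow> 0 \<le> L \<omega>"
    and L': "L' \<in> borel_measurable G" "\<And>\<omega>. \<omega> \<in> space M \<Longrightarrow> 0 \<le> L' \<omega>"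
  shows "(\<integral>\<^sup>+\<omega>. ennreal \<bar>real (N (L \<omega>) \<omega>) - real (N (L' \<omega>) \<omega>)\<bar> \<partial>M) \<le> (\<integral>\<^sup>+\<omega>. ennreal \<bar>L \<omega> - L' \<omega>\<bar> \<partial>M)"
proof -
  define q where "q n i = real (Suc i) / real (Suc n)" for n i
  define k where "k n x = nat \<lfloor>x * real (Suc n)\<rfloor>" for n and x :: real
  define u where "u n \<omega> = ennreal \<bar>real (N (q n (k n (L \<omega>))) \<omega>) - real (N (q n (k n (L' \<omega>))) \<omega>)\<bar>" for n \<omega>
  have q0: "0 \<le> q n i" for n i
    by (simp add: q_def)
  \<comment> \<open>The shift by one in \<open>q\<close> makes the grid point strictly larger than
    \<open>x\<close>. Thus it converges along \<open>at_right x\<close>, the filter in which the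
    paths are continuous.\<close>
  have q: "x < q n (k n x)" "q n (k n x) \<le> x + 1 / real (Suc n)" if "0 \<le> x" for n x
  proof -
    have "real (k n x) \<le> x * real (Suc n)" "x * real (Suc n) < real (k n x) + 1"
      using that by (simp_all add: k_def of_nat_nat del: of_nat_Suc)
    moreover have "0 < real (Suc n)" by simp
    ultimately show "x < q n (k n x)" "q n (k n x) \<le> x + 1 / real (Suc n)"
      unfolding q_def of_nat_Suc[of "k n x"]
      by (simp_all only: pos_less_divide_eq pos_divide_le_eq distrib_right) simp
  qed
  have q_lim: "filterlim (\<lambda>n. q n (k n x)) (at_right x) sequentially" if "0 \<le> x" for x
  proof (rule tendsto_imp_filterlim_at_right)
    show "(\<lambda>n. q n (k n x)) \<longlonglongrightarrow> x"
    proof (rule tendsto_sandwich[OF _ _ tendsto_const])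
      show "(\<lambda>n. x + 1 / real (Suc n)) \<longlonglongrightarrow> x"
        using tendsto_add[OF tendsto_const LIMSEQ_inverse_real_of_nat, of x] by (simp add: inverse_eq_divide)
    qed (use q[OF that] in \<open>auto intro!: always_eventually less_imp_le\<close>)
  qed (use q[OF that] in auto)
  have sets: "sets G \<subseteq> sets M"
    using indep by (auto simp: indep_set_def indep_sets_def UNIV_bool)
  have [measurable]: "L \<in> borel_measurable M" "L' \<in> borel_measurable M"
    using L(1) L'(1) sets by (auto simp: measurable_def)
  have k_meas [measurable]: "k n \<in> measurable borel (count_space UNIV)" for n
    unfolding k_def by measurable
  have N_meas [measurable]: "N (q n i) \<in> measurable M (count_space UNIV)" for n i
    using N q0 by (auto simp: unit_poisson_process_def)
  \<comment> \<open>Measurability with respect to \<open>G\<close>, and not just \<open>M\<close>,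
    places the events that fix both grid indices among those independent of the process.\<close>
  have K: "(\<lambda>\<omega>. (k n (L \<omega>), k n (L' \<omega>))) \<in> measurable G (count_space UNIV)" for n
    using L(1) L'(1) by measurable
  have K_M [measurable]: "(\<lambda>\<omega>. (k n (L \<omega>), k n (L' \<omega>))) \<in> measurable M (count_space UNIV)" for n
    by measurable
  \<comment> \<open>Only countably many grid times occur, so measurability at each fixed time
    suffices here.\<close>
  have u_meas [measurable]: "u n \<in> borel_measurable M" for n
    unfolding u_def
    using measurable_compose_countable[OF _ K_M[of n],
        of "\<lambda>p \<omega>. ennreal \<bar>real (N (q n (fst p)) \<omega>) - real (N (q n (snd p)) \<omega>)\<bar>" borel]
    by simp
  have int_u: "(\<integral>\<^sup>+\<omega>. u n \<omega> \<partial>M) = (\<integral>\<^sup>+\<omega>. ennreal \<bar>q n (k n (L \<omega>)) - q n (k n (L' \<omega>))\<bar> \<partial>M)" for n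
  proof -
    define h where "h p \<omega> = ennreal \<bar>real (N (q n (fst p)) \<omega>) - real (N (q n (snd p)) \<omega>)\<bar>" for p :: "nat \<times> nat" and \<omega>
    define c where "c p = ennreal \<bar>q n (fst p) - q n (snd p)\<bar>" for p :: "nat \<times> nat"
    have "(\<integral>\<^sup>+\<omega>. h (k n (L \<omega>), k n (L' \<omega>)) \<omega> \<partial>M) = (\<integral>\<^sup>+\<omega>. c (k n (L \<omega>), k n (L' \<omega>)) \<partial>M)"
    proof (rule nn_integral_compose_countable)
      show "h p \<in> borel_measurable M" for p
        unfolding h_def by measurable
      fix p :: "nat \<times> nat"
      define A where "A = {\<omega> \<in> space M. (k n (L \<omega>), k n (L' \<omega>)) = p}"
      define W where "W \<omega> = nat \<bar>int (N (q n (fst p)) \<omega>) - int (N (q n (snd p)) \<omega>)\<bar>" for \<omega>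
      have h_W: "h p \<omega> = of_nat (W \<omega>)" for \<omega>
        unfolding h_def W_def by (simp add: ennreal_of_nat_eq_real_of_nat)
      have "N (q n i) \<in> measurable (gen_sigma M N {0..}) (count_space UNIV)" for i
        by (rule measurable_gen_sigma) (simp add: q0)
      then have "W \<in> measurable (gen_sigma M N {0..}) (count_space UNIV)"
        unfolding W_def by measurable
      moreover have "A \<in> sets G"
        using measurable_sets[OF K, of "{p}" n] by (simp add: A_def vimage_def Int_def conj_commute)
      ultimately have "(\<integral>\<^sup>+\<omega>. h p \<omega> * indicator A \<omega> \<partial>M) = (\<integral>\<^sup>+\<omega>. h p \<omega> \<partial>M) * emeasure M A"
        unfolding h_W by (intro nn_integral_nat_indicator_indep[OF indep]) auto
      also have "(\<integral>\<^sup>+\<omega>. h p \<omega> \<partial>M) = c p"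
        unfolding h_def c_def by (intro nn_integral_abs_diff_unit_poisson_process N q0)
      finally show "(\<integral>\<^sup>+\<omega>. h p \<omega> * indicator {\<omega> \<in> space M. (k n (L \<omega>), k n (L' \<omega>)) = p} \<omega> \<partial>M) =
          c p * emeasure M {\<omega> \<in> space M. (k n (L \<omega>), k n (L' \<omega>)) = p}"
        by (simp add: A_def)
    qed measurable
    then show ?thesis
      by (simp add: h_def c_def u_def)
  qed
  \<comment> \<open>Both intensities are rounded upwards by at most \<open>1 / Suc n\<close>, so
    their difference changes by at most that amount, not twice as much.\<close>
  have int_u_le: "(\<integral>\<^sup>+\<omega>. u n \<omega> \<partial>M) \<le> (\<integral>\<^sup>+\<omega>. ennreal \<bar>L \<omega> - L' \<omega>\<bar> \<partial>M) + ennreal (1 / real (Suc n))" for n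
  proof -
    have "(\<integral>\<^sup>+\<omega>. u n \<omega> \<partial>M) \<le> (\<integral>\<^sup>+\<omega>. ennreal \<bar>L \<omega> - L' \<omega>\<bar> + ennreal (1 / real (Suc n)) \<partial>M)"
      unfolding int_u
    proof (rule nn_integral_mono)
      fix \<omega> assume "\<omega> \<in> space M"
      then have "\<bar>q n (k n (L \<omega>)) - q n (k n (L' \<omega>))\<bar> \<le> \<bar>L \<omega> - L' \<omega>\<bar> + 1 / real (Suc n)"
        using q[of "L \<omega>" n] q[of "L' \<omega>" n] L(2) L'(2) by (simp add: abs_if del: of_nat_Suc)
      then show "ennreal \<bar>q n (k n (L \<omega>)) - q n (k n (L' \<omega>))\<bar>
          \<le> ennreal \<bar>L \<omega> - L' \<omega>\<bar> + ennreal (1 / real (Suc n))"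
        by (simp add: ennreal_plus[symmetric] ennreal_leI del: ennreal_plus of_nat_Suc)
    qed
    then show ?thesis
      by (simp add: nn_integral_add emeasure_space_1 del: of_nat_Suc)
  qed
  have "AE \<omega> in M. \<forall>s\<ge>0. continuous (at_right s) (\<lambda>u. N u \<omega>)"
    using N by (auto simp: unit_poisson_process_def)
  \<comment> \<open>Expresses the integrand at the random times through the measurable
    \<open>u n\<close>, so that Fatou's lemma applies.\<close>
  then have "AE \<omega> in M. ennreal \<bar>real (N (L \<omega>) \<omega>) - real (N (L' \<omega>) \<omega>)\<bar> = liminf (\<lambda>n. u n \<omega>)"
    using AE_space
  proof eventually_elim
    case (elim \<omega>)
    \<comment> \<open>The counts are natural numbers, so convergence means being eventually
      constant.\<close>
    have ev: "\<forall>\<^sub>F n in sequentially. N (q n (k n x)) \<omega> = N x \<omega>" if "0 \<le> x" for x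
    proof -
      have "((\<lambda>u. N u \<omega>) \<longlongrightarrow> N x \<omega>) (at_right x)"
        using elim that by (auto simp: continuous_within)
      then have "(\<lambda>n. N (q n (k n x)) \<omega>) \<longlonglongrightarrow> N x \<omega>"
        by (rule filterlim_compose[OF _ q_lim[OF that]])
      then show ?thesis by (simp add: tendsto_discrete)
    qed
    have "\<forall>\<^sub>F n in sequentially. u n \<omega> = ennreal \<bar>real (N (L \<omega>) \<omega>) - real (N (L' \<omega>) \<omega>)\<bar>"
      using ev[OF L(2)[OF elim(2)]] ev[OF L'(2)[OF elim(2)]] by eventually_elim (simp add: u_def)
    then show ?case
      by (intro lim_imp_Liminf[symmetric] tendsto_eventually) auto
  qed
  then have "(\<integral>\<^sup>+\<omega>. ennreal \<bar>real (N (L \<omega>) \<omega>) - real (N (L' \<omega>) \<omega>)\<bar> \<partial>M) = (\<integral>\<^sup>+\<omega>. liminf (\<lambda>n. u n \<omega>) \<partial>M)"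
    by (rule nn_integral_cong_AE)
  also have "\<dots> \<le> liminf (\<lambda>n. \<integral>\<^sup>+\<omega>. u n \<omega> \<partial>M)"
    by (rule nn_integral_liminf) simp
  also have "\<dots> \<le> liminf (\<lambda>n. (\<integral>\<^sup>+\<omega>. ennreal \<bar>L \<omega> - L' \<omega>\<bar> \<partial>M) + ennreal (1 / real (Suc n)))"
    by (intro Liminf_mono always_eventually allI int_u_le)
  also have "\<dots> = (\<integral>\<^sup>+\<omega>. ennreal \<bar>L \<omega> - L' \<omega>\<bar> \<partial>M)"
  proof (rule lim_imp_Liminf)
    have "(\<lambda>n. ennreal (1 / real (Suc n))) \<longlonglongrightarrow> ennreal 0"
      using LIMSEQ_inverse_real_of_nat by (intro tendsto_ennrealI) (simp add: inverse_eq_divide)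
    from tendsto_add[OF tendsto_const this]
    show "(\<lambda>n. (\<integral>\<^sup>+\<omega>. ennreal \<bar>L \<omega> - L' \<omega>\<bar> \<partial>M) + ennreal (1 / real (Suc n)))
        \<longlonglongrightarrow> (\<integral>\<^sup>+\<omega>. ennreal \<bar>L \<omega> - L' \<omega>\<bar> \<partial>M)"
      by simp
  qed simp
  finally show ?thesis .
qed

section \<open>The two coupled processes and their distance\<close>

lemma past_in_space: "past X t \<omega> \<in> space seq_space"
  by (auto simp: past_def seq_space_def space_PiM space_restrict_space)

lemma measurable_past:
  assumes "\<And>s. s < t \<Longrightarrow> X s \<in> measurable G (count_space UNIV)"
  shows "past X t \<in> measurable G seq_space"
  unfolding past_def seq_space_def
proof (rule measurable_restrict)
  fix k :: nat assume "k \<in> {1..}"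
  then have [measurable]: "X (t - int k) \<in> measurable G (count_space UNIV)"
    by (intro assms) auto
  show "(\<lambda>\<omega>. real (X (t - int k) \<omega>)) \<in> measurable G (restrict_space borel {0..})"
    by (intro measurable_restrict_space2) auto
qed

theorem lemma7p1:
  fixes \<Theta> :: "(real ^ 'd) set"
    and f :: "real ^ 'd \<Rightarrow> (nat \<Rightarrow> real) \<Rightarrow> real"
    and \<theta>star :: "real ^ 'd"
    and \<alpha> :: "nat \<Rightarrow> real"
    and \<gamma> :: real
    and kstar :: int
    and M :: "'a measure"
    and Y Y' :: "int \<Rightarrow> 'a \<Rightarrow> nat"
    and N :: "int \<Rightarrow> real \<Rightarrow> 'a \<Rightarrow> nat"
  assumes "compact \<Theta>"
    and "\<And>\<theta>. \<theta> \<in> \<Theta> \<Longrightarrow> f \<theta> \<in> borel_measurable seq_space"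
    and "\<And>\<theta> y. \<theta> \<in> \<Theta> \<Longrightarrow> y \<in> space seq_space \<Longrightarrow> 0 \<le> f \<theta> y"
    and "\<And>y. y \<in> space seq_space \<Longrightarrow> C2_on \<Theta> (\<lambda>\<theta>. f \<theta> y)"
    and "prob_space M"
    and "\<And>t. Y t \<in> measurable M (count_space UNIV)"
    and "\<And>t. t > kstar \<Longrightarrow>
           cond_poisson M (gen_sigma M Y {..t - 1}) (Y t) (\<lambda>\<omega>. f \<theta>star (past Y t \<omega>))"
    and "\<And>t. t > kstar \<Longrightarrow>
           AE \<omega> in M. real_cond_exp M (gen_sigma M Y {..t - 1}) (\<lambda>\<omega>. real (Y t \<omega>)) \<omega>
                        = f \<theta>star (past Y t \<omega>)"
    and "\<theta>star \<in> interior \<Theta>"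
    and "assumption_D \<Theta> f"
    and "assumption_Id M Y kstar \<Theta> f"
    and "assumption_A0 \<Theta> f \<alpha>"
    and "\<gamma> > 3 / 2"
    and "\<alpha> \<in> O(\<lambda>j. real j powr (- \<gamma>))"
    and "\<And>r::nat. r \<ge> 1 \<Longrightarrow>
           \<exists>C>0. \<forall>t\<le>kstar. (\<integral>\<^sup>+ \<omega>. ennreal (real (Y t \<omega>) ^ r) \<partial>M) \<le> ennreal C"
    and "stationary_regime M (f \<theta>star) Y'"
    and "poisson_coupling M kstar (f \<theta>star) N Y Y'"
  shows "\<exists>C>0. \<forall>l::nat. l \<ge> 1 \<longrightarrow>
           (\<integral>\<^sup>+ \<omega>. ennreal \<bar>real (Y (kstar + int l) \<omega>) - real (Y' (kstar + int l) \<omega>)\<bar> \<partial>M)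
             \<le> ennreal (C * (INF p\<in>{1..l}.
                   (\<Sum>\<^sub>\<infinity>k\<in>{1..}. \<alpha> k) powr (real l / real p) + (\<Sum>\<^sub>\<infinity>k\<in>{p..}. \<alpha> k)))"
proof -
  interpret prob_space M by fact
  define g where "g = f \<theta>star"
  define a where "a = (\<Sum>\<^sub>\<infinity>k\<in>{1..}. \<alpha> k)"
  \<comment> \<open>Time is counted from \<open>kstar\<close>, so the uncontrolled prehistory is
    \<open>l\<close> at or below 0. With values in \<open>ennreal\<close>, the renewal inequality
    can be stated before any finiteness is known.\<close>
  define d where "d l = (\<integral>\<^sup>+\<omega>. ennreal \<bar>real (Y (kstar + l) \<omega>) - real (Y' (kstar + l) \<omega>)\<bar> \<partial>M)" for l
  have "\<theta>star \<in> \<Theta>"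
    using assms(9) interior_subset by blast
  note g_meas = assms(2)[OF \<open>\<theta>star \<in> \<Theta>\<close>, folded g_def]
  note g_nonneg = assms(3)[OF \<open>\<theta>star \<in> \<Theta>\<close>, folded g_def]
  have Y_meas [measurable]: "Y t \<in> measurable M (count_space UNIV)" for t by fact
  have Y'_meas [measurable]: "Y' t \<in> measurable M (count_space UNIV)" for t
    using assms(16) by (simp add: stationary_regime_def)
  note coupling = assms(17)[folded g_def, unfolded poisson_coupling_def]
  have \<alpha>: "\<And>k. k \<ge> 1 \<Longrightarrow> 0 \<le> \<alpha> k" "\<alpha> summable_on {1..}" "a < 1"
    using assms(12) by (auto simp: assumption_A0_def a_def)
  have lipschitz: "ennreal \<bar>g y - g y'\<bar> \<le> (\<Sum>\<^sub>\<infinity>k\<in>{1..}. ennreal (\<alpha> k * \<bar>y k - y' k\<bar>))"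
    if "y \<in> space seq_space" "y' \<in> space seq_space" for y y'
  proof -
    have "ennreal \<bar>g y - g y'\<bar> \<le> sup_norm \<Theta> (\<lambda>\<theta>. f \<theta> y - f \<theta> y')"
      unfolding sup_norm_def g_def by (rule SUP_upper) fact
    also have "\<dots> \<le> (\<Sum>\<^sub>\<infinity>k\<in>{1..}. ennreal (\<alpha> k * \<bar>y k - y' k\<bar>))"
      using assms(12) that by (simp add: assumption_A0_def)
    finally show ?thesis .
  qed

  have step: "d l \<le> (\<Sum>\<^sub>\<infinity>k\<in>{1..}. ennreal (\<alpha> k) * d (l - int k))" if "l \<ge> 1" for l
  proof -
    define t where "t = kstar + l"
    \<comment> \<open>The joint past of both processes: \<open>N t\<close> is independent of it, and
      both intensities are measurable with respect to it.\<close>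
    define G where "G = gen_sigma M (\<lambda>s \<omega>. (Y s \<omega>, Y' s \<omega>)) {..<t}"
    have "t > kstar" using that by (simp add: t_def)
    have pair: "(\<lambda>\<omega>. (Y s \<omega>, Y' s \<omega>)) \<in> measurable G (count_space UNIV)" if "s < t" for s
      unfolding G_def using that by (intro measurable_gen_sigma) auto
    have past_Y: "past Y t \<in> measurable G seq_space"
      using measurable_compose[OF pair, of _ fst] by (intro measurable_past) simp
    have past_Y': "past Y' t \<in> measurable G seq_space"
      using measurable_compose[OF pair, of _ snd] by (intro measurable_past) simp
    have "AE \<omega> in M. Y t \<omega> = N t (g (past Y t \<omega>)) \<omega>" "AE \<omega> in M. Y' t \<omega> = N t (g (past Y' t \<omega>)) \<omega>"
      using coupling \<open>t > kstar\<close> by auto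
    then have "d l = (\<integral>\<^sup>+\<omega>. ennreal \<bar>real (N t (g (past Y t \<omega>)) \<omega>) - real (N t (g (past Y' t \<omega>)) \<omega>)\<bar> \<partial>M)"
      unfolding d_def t_def[symmetric] by (intro nn_integral_cong_AE, eventually_elim) simp
    also have "\<dots> \<le> (\<integral>\<^sup>+\<omega>. ennreal \<bar>g (past Y t \<omega>) - g (past Y' t \<omega>)\<bar> \<partial>M)"
    proof (rule nn_integral_abs_diff_poisson_coupling_le)
      show "unit_poisson_process M (N t)" "indep_set (sets (gen_sigma M (N t) {0..})) (sets G)"
        using coupling \<open>t > kstar\<close> by (auto simp: G_def)
      show "(\<lambda>\<omega>. g (past Y t \<omega>)) \<in> borel_measurable G" "(\<lambda>\<omega>. g (past Y' t \<omega>)) \<in> borel_measurable G"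
        using measurable_compose[OF past_Y g_meas] measurable_compose[OF past_Y' g_meas] by auto
    qed (auto simp: G_def intro: g_nonneg past_in_space)
    also have "\<dots> \<le> (\<integral>\<^sup>+\<omega>. (\<Sum>\<^sub>\<infinity>k\<in>{1..}. ennreal (\<alpha> k * \<bar>past Y t \<omega> k - past Y' t \<omega> k\<bar>)) \<partial>M)"
      by (intro nn_integral_mono lipschitz past_in_space)
    also have "\<dots> = (\<integral>\<^sup>+\<omega>. (\<Sum>\<^sub>\<infinity>k\<in>{1..}. ennreal (\<alpha> k) * ennreal \<bar>real (Y (t - int k) \<omega>) - real (Y' (t - int k) \<omega>)\<bar>) \<partial>M)"
      by (intro nn_integral_cong infsum_cong) (use \<alpha>(1) in \<open>auto simp: past_def ennreal_mult\<close>)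
    also have "\<dots> = (\<Sum>\<^sub>\<infinity>k\<in>{1..}. \<integral>\<^sup>+\<omega>. ennreal (\<alpha> k) * ennreal \<bar>real (Y (t - int k) \<omega>) - real (Y' (t - int k) \<omega>)\<bar> \<partial>M)"
      by (rule nn_integral_infsum) measurable
    also have "\<dots> = (\<Sum>\<^sub>\<infinity>k\<in>{1..}. ennreal (\<alpha> k) * d (l - int k))"
      by (simp add: nn_integral_cmult d_def t_def algebra_simps)
    finally show ?thesis .
  qed

  \<comment> \<open>Before \<open>kstar\<close> the processes need not be close. The triangle
    inequality bounds their distance by the sum of the means: \<open>B1\<close> from the
    first-moment bound on \<open>Y\<close>, \<open>B2\<close> from the constant mean of
    \<open>Y'\<close>.\<close>
  obtain B where "B \<ge> 0" and init: "\<And>l. l \<le> 0 \<Longrightarrow> d l \<le> ennreal B"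
  proof -
    obtain B1 where "B1 > 0" and B1: "\<And>t. t \<le> kstar \<Longrightarrow> (\<integral>\<^sup>+\<omega>. ennreal (real (Y t \<omega>)) \<partial>M) \<le> ennreal B1"
      using assms(15)[of 1] by auto
    define m where "m t = (\<integral>\<^sup>+\<omega>. ennreal (real (Y' t \<omega>)) \<partial>M)" for t
    \<comment> \<open>Strict stationarity is used for the single coordinate 0 shifted by
      \<open>t\<close>; reading off that coordinate turns equality of laws into equality of
      means.\<close>
    have m_const: "m t = m 0" for t
    proof -
      have eq: "distr M (\<Pi>\<^sub>M t\<in>{0}. count_space UNIV) (\<lambda>\<omega>. \<lambda>s\<in>{0}. Y' (s + t) \<omega>) =
            distr M (\<Pi>\<^sub>M t\<in>{0}. count_space UNIV) (\<lambda>\<omega>. \<lambda>s\<in>{0}. Y' s \<omega>)"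
        using assms(16) by (simp add: stationary_regime_def strictly_stationary_def)
      have "(\<integral>\<^sup>+x. ennreal (real (x 0)) \<partial>distr M (\<Pi>\<^sub>M t\<in>{0::int}. count_space UNIV) (\<lambda>\<omega>. \<lambda>s\<in>{0}. Y' (s + r) \<omega>)) = m r" for r
      proof -
        have [measurable]: "(\<lambda>\<omega>. \<lambda>s\<in>{0}. Y' (s + r) \<omega>) \<in> measurable M (\<Pi>\<^sub>M t\<in>{0::int}. count_space UNIV)"
          by (rule measurable_restrict) simp
        have [measurable]: "(\<lambda>x. x 0) \<in> measurable (\<Pi>\<^sub>M t\<in>{0::int}. count_space (UNIV :: nat set)) (count_space UNIV)"
          by (rule measurable_component_singleton) simp
        show ?thesis
          by (subst nn_integral_distr) (auto simp: m_def)
      qed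
      from this[of t] this[of 0] show ?thesis
        using eq by simp
    qed
    have "integrable M (\<lambda>\<omega>. real (Y' 0 \<omega>) ^ 1)"
      using assms(16) unfolding stationary_regime_def by blast
    then have "m 0 < \<infinity>"
      unfolding m_def by (simp add: integrable_iff_bounded)
    then obtain B2 where "B2 \<ge> 0" "m 0 = ennreal B2"
      by (auto simp: less_top_ennreal)
    show thesis
    proof (rule that[of "B1 + B2"])
      show "B1 + B2 \<ge> 0" using \<open>B1 > 0\<close> \<open>B2 \<ge> 0\<close> by simp
      fix l :: int assume "l \<le> 0"
      have "d l \<le> (\<integral>\<^sup>+\<omega>. ennreal (real (Y (kstar + l) \<omega>)) + ennreal (real (Y' (kstar + l) \<omega>)) \<partial>M)"
        unfolding d_def
        by (intro nn_integral_mono) (auto simp: ennreal_plus[symmetric] simp del: ennreal_plus intro!: ennreal_leI)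
      also have "\<dots> = (\<integral>\<^sup>+\<omega>. ennreal (real (Y (kstar + l) \<omega>)) \<partial>M) + m (kstar + l)"
        unfolding m_def by (rule nn_integral_add) auto
      also have "\<dots> \<le> ennreal B1 + ennreal B2"
        using B1[of "kstar + l"] \<open>l \<le> 0\<close> m_const[of "kstar + l"] \<open>m 0 = ennreal B2\<close>
        by (intro add_mono) auto
      finally show "d l \<le> ennreal (B1 + B2)"
        using \<open>B1 > 0\<close> \<open>B2 \<ge> 0\<close> by simp
    qed
  qed

  \<comment> \<open>The added 1 keeps \<open>C\<close> positive when \<open>B = 0\<close>.\<close>
  define C where "C = B / (1 - a) + 1"
  have "C > 0"
    using \<open>B \<ge> 0\<close> \<alpha>(3) by (auto simp: C_def intro!: add_nonneg_pos)
  show ?thesis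
  proof (intro exI[of _ C] conjI allI impI \<open>C > 0\<close>)
    fix l :: nat assume "l \<ge> 1"
    define R where "R p = a powr (real l / real p) + (\<Sum>\<^sub>\<infinity>k\<in>{p..}. \<alpha> k)" for p
    \<comment> \<open>The infimum runs over a finite nonempty set, so it is attained at some
      \<open>p\<close>. As the constant in the renewal bound does not depend on \<open>p\<close>,
      that bound can be used at the minimiser.\<close>
    have "(INF p\<in>{1..l}. R p) \<in> R ` {1..l}"
      using \<open>l \<ge> 1\<close> by (subst cInf_eq_Min) (auto intro!: Min_in)
    then obtain p where p: "p \<in> {1..l}" "(INF p\<in>{1..l}. R p) = R p"
      by auto
    have "0 \<le> R p"
      unfolding R_def using p \<alpha>(1) by (auto intro!: add_nonneg_nonneg infsum_nonneg)
    have "d (int l) \<le> ennreal (B / (1 - a) * R p)"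
      using renewal_inequality_bound[of \<alpha> B d "int l" p] \<alpha> \<open>B \<ge> 0\<close> init step \<open>l \<ge> 1\<close> p
      by (simp add: R_def a_def)
    also have "\<dots> \<le> ennreal (C * R p)"
      using \<open>0 \<le> R p\<close> by (intro ennreal_leI mult_right_mono) (simp_all add: C_def)
    finally show "(\<integral>\<^sup>+\<omega>. ennreal \<bar>real (Y (kstar + int l) \<omega>) - real (Y' (kstar + int l) \<omega>)\<bar> \<partial>M)
        \<le> ennreal (C * (INF p\<in>{1..l}. (\<Sum>\<^sub>\<infinity>k\<in>{1..}. \<alpha> k) powr (real l / real p) + (\<Sum>\<^sub>\<infinity>k\<in>{p..}. \<alpha> k)))"
      unfolding d_def p(2)[symmetric] unfolding R_def a_def .
  qed
qed

end
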